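(* Let $n,m\in\mathbb{N}$ be positive integers with $n$ odd, and let $G = D_n\times\mathbb{Z}/m\mathbb{Z}$, where $D_n$ is the dihedral group of order $2n$. Up to automorphisms of $F_2$ there exists only one origami-curve of normal origamis with Galois group $G$. That is, the set $$\mathrm{Aut}(G)\backslash\mathrm{Epi}(F_2,G)/\mathrm{Aut}(F_2)$$ has exactly one element: surjective homomorphisms $F_2\to G$ exist, and for any two of them $f,f':F_2\to G$ there are $\varphi\in\mathrm{Aut}(F_2)$ and $\psi\in\mathrm{Aut}(G)$ with $f'=\psi\circ f\circ\varphi$.
   Context: $F_2$ is the free group on two generators $x,y$, and $\mathrm{Epi}(F_2,G)$ is the set of surjective homomorphisms $F_2\to G$, on which $\mathrm{Aut}(G)$ acts by post-composition and $\mathrm{Aut}(F_2)$ by pre-composition (inner automorphisms of $F_2$ act trivially modulo $\mathrm{Aut}(G)$, so one may equally write $\mathrm{Out}(F_2)$). A (complex) origami is a covering $p:X\to E$ of a connected surface $X$ over the torus $E=\mathbb{R}^2/\mathbb{Z}^2$ ramified at most over $0\in E$. It is normal with Galois group $G$ if $G$ acts on $X$ with $E=X/G$; its monodromy is then a surjective homomorphism $f:F_2=\pi_1(E\setminus\{0\})\to G$, well-defined up to $\mathrm{Aut}(G)$, where $x,y$ are the horizontal and vertical closed paths. Varying the complex structure of the torus by $A\in\mathrm{SL}_2(\mathbb{R})$ gives Riemann surfaces $X_A$, which form an algebraic curve in the moduli space of Riemann surfaces, the origami-curve of the origami. The origami-curves of normal origamis with Galois group $G$ are identified with the elements of $\mathrm{Aut}(G)\backslash\mathrm{Epi}(F_2,G)/\mathrm{Out}(F_2)$.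 *)

theory Defs
  imports "HOL-Algebra.Algebra"
begin

section \<open>The free group on two generators\<close>

text \<open>
  Elements are the reduced words in the letters $x^{\pm 1}, y^{\pm 1}$. A letter is a pair of a
  generator and an exponent sign, where \<^term>\<open>True\<close> stands for the exponent \<open>+1\<close>.
\<close>

datatype generator = X | Y

type_synonym letter = "generator \<times> bool"

definition inv_letter :: "letter \<Rightarrow> letter" where
  "inv_letter l = (fst l, \<not> snd l)"

fun reduced :: "letter list \<Rightarrow> bool" where
  "reduced (a # b # w) \<longleftrightarrow> b \<noteq> inv_letter a \<and> reduced (b # w)"
| "reduced _ \<longleftrightarrow> True"

text \<open>Left multiplication of a reduced word by a letter, with cancellation.\<close>

fun push :: "letter \<Rightarrow> letter list \<Rightarrow> letter list" where
  "push a [] = [a]"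
| "push a (b # w) = (if b = inv_letter a then w else a # b # w)"

definition F2 :: "letter list monoid" where
  "F2 = \<lparr>carrier = {w. reduced w}, monoid.mult = (\<lambda>u v. foldr push u v), one = []\<rparr>"

lemma inv_letter_inv_letter [simp]: "inv_letter (inv_letter a) = a"
  by (simp add: inv_letter_def)

lemma reduced_ConsD: "reduced (a # w) \<Longrightarrow> reduced w"
  by (cases w) auto

lemma reduced_push: "reduced w \<Longrightarrow> reduced (push a w)"
  by (cases w) (auto dest: reduced_ConsD)

lemma reduced_foldr_push: "reduced v \<Longrightarrow> reduced (foldr push u v)"
  by (induction u) (auto intro: reduced_push)

lemma push_inv_letter: "reduced w \<Longrightarrow> push a (push (inv_letter a) w) = w"
proof (cases w)
  case (Cons b v)
  assume "reduced w"
  then show ?thesis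
    using Cons by (cases v) auto
qed auto

lemma push_inv_letter': "reduced w \<Longrightarrow> push (inv_letter a) (push a w) = w"
  using push_inv_letter[of w "inv_letter a"] by simp

lemma foldr_push_push:
  "reduced w \<Longrightarrow> foldr push (push a v) w = push a (foldr push v w)"
  by (cases v) (auto simp: push_inv_letter reduced_foldr_push)

lemma foldr_push_assoc:
  "reduced w \<Longrightarrow> foldr push (foldr push u v) w = foldr push u (foldr push v w)"
  by (induction u) (auto simp: foldr_push_push)

lemma foldr_push_Nil: "reduced w \<Longrightarrow> foldr push w [] = w"
proof (induction w)
  case (Cons a w)
  then show ?case
    using reduced_ConsD[of a w] by (cases w) auto
qed auto

lemma foldr_push_left_inv:
  "reduced v \<Longrightarrow> foldr push (rev (map inv_letter u)) (foldr push u v) = v"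
  by (induction u arbitrary: v) (auto simp: push_inv_letter' reduced_foldr_push)

lemma group_F2: "group F2"
proof (rule groupI)
  fix w assume w: "w \<in> carrier F2"
  let ?v = "foldr push (rev (map inv_letter w)) []"
  have "foldr push ?v w = foldr push (rev (map inv_letter w)) (foldr push [] w)"
    using w by (intro foldr_push_assoc) (auto simp: F2_def)
  also have "foldr push [] w = foldr push w []"
    using w by (simp add: F2_def foldr_push_Nil)
  finally have "foldr push ?v w = []"
    using foldr_push_left_inv[of "[]" w] by simp
  then show "\<exists>v\<in>carrier F2. v \<otimes>\<^bsub>F2\<^esub> w = \<one>\<^bsub>F2\<^esub>"
    by (intro bexI[of _ ?v]) (auto simp: F2_def reduced_foldr_push)
qed (auto simp: F2_def reduced_foldr_push foldr_push_assoc)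

text \<open>The universal property of the free group on the basis $x, y$.\<close>

definition letter_val :: "('a, 'b) monoid_scheme \<Rightarrow> (generator \<Rightarrow> 'a) \<Rightarrow> letter \<Rightarrow> 'a" where
  "letter_val G g l = (if snd l then g (fst l) else inv\<^bsub>G\<^esub> g (fst l))"

definition word_val :: "('a, 'b) monoid_scheme \<Rightarrow> (generator \<Rightarrow> 'a) \<Rightarrow> letter list \<Rightarrow> 'a" where
  "word_val G g w = foldr (\<lambda>l a. letter_val G g l \<otimes>\<^bsub>G\<^esub> a) w \<one>\<^bsub>G\<^esub>"

lemma F2_universal_property:
  fixes G (structure)
  assumes "group G" and g: "\<And>z. g z \<in> carrier G"
  shows "\<exists>!f. f \<in> hom F2 G \<inter> extensional (carrier F2) \<and> (\<forall>z. f [(z, True)] = g z)"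
proof (rule ex_ex1I)
  interpret group G by fact
  have lv [simp]: "letter_val G g l \<in> carrier G" for l
    by (simp add: letter_val_def g)
  have lv_inv: "letter_val G g (inv_letter l) = inv (letter_val G g l)" for l
    by (simp add: letter_val_def inv_letter_def g)
  have wv [simp]: "word_val G g w \<in> carrier G" for w
    by (induction w) (auto simp: word_val_def)
  have wv_Cons: "word_val G g (a # w) = letter_val G g a \<otimes> word_val G g w" for a w
    by (simp add: word_val_def)
  have push: "word_val G g (push a w) = letter_val G g a \<otimes> word_val G g w" for a w
    by (cases w) (auto simp: wv_Cons lv_inv word_val_def[of _ _ "[]"] m_assoc[symmetric])
  have app: "word_val G g (foldr push u v) = word_val G g u \<otimes> word_val G g v" for u v
    by (induction u) (auto simp: push wv_Cons word_val_def[of _ _ "[]"] m_assoc)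
  show "\<exists>f. f \<in> hom F2 G \<inter> extensional (carrier F2) \<and> (\<forall>z. f [(z, True)] = g z)"
    by (rule exI[of _ "restrict (word_val G g) (carrier F2)"])
       (auto simp: hom_def F2_def app reduced_foldr_push word_val_def[of _ _ "[_]"] letter_val_def g)
next
  interpret group G by fact
  interpret F: group F2 by (rule group_F2)
  fix f f'
  assume f: "f \<in> hom F2 G \<inter> extensional (carrier F2) \<and> (\<forall>z. f [(z, True)] = g z)"
    and f': "f' \<in> hom F2 G \<inter> extensional (carrier F2) \<and> (\<forall>z. f' [(z, True)] = g z)"
  have letter: "h [l] = letter_val G g l"
    if h: "h \<in> hom F2 G" "\<forall>z. h [(z, True)] = g z" for h l
  proof -
    interpret h: group_hom F2 G h
      using h by unfold_locales
    have "[(fst l, False)] = inv\<^bsub>F2\<^esub> [(fst l, True)]"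
      by (rule F.inv_equality[symmetric]) (auto simp: F2_def inv_letter_def)
    moreover have "[(fst l, True)] \<in> carrier F2"
      by (simp add: F2_def)
    ultimately have "h [(fst l, False)] = inv (h [(fst l, True)])"
      by (simp only: h.hom_inv)
    then show ?thesis
      using h by (cases l; cases "snd l") (auto simp: letter_val_def)
  qed
  have word: "h w = word_val G g w"
    if h: "h \<in> hom F2 G" "\<forall>z. h [(z, True)] = g z" and "reduced w" for h w
    using \<open>reduced w\<close>
  proof (induction w)
    case Nil
    have "h \<one>\<^bsub>F2\<^esub> = \<one>"
      by (rule hom_one[OF h(1) group_F2 \<open>group G\<close>])
    then show ?case by (simp add: F2_def word_val_def)
  next
    case (Cons a w)
    have w: "reduced w" using Cons.prems by (rule reduced_ConsD)
    have "a # w = [a] \<otimes>\<^bsub>F2\<^esub> w"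
      using Cons.prems by (cases w) (auto simp: F2_def)
    moreover have "h ([a] \<otimes>\<^bsub>F2\<^esub> w) = h [a] \<otimes> h w"
      using w by (intro hom_mult[OF h(1)]) (auto simp: F2_def)
    ultimately have "h (a # w) = h [a] \<otimes> h w"
      by simp
    then show ?case
      using Cons.IH[OF w] letter[OF h] by (simp add: word_val_def)
  qed
  show "f = f'"
  proof (rule extensionalityI[of _ "carrier F2"])
    fix w assume "w \<in> carrier F2"
    then show "f w = f' w"
      using f f' word[of f w] word[of f' w] by (auto simp: F2_def)
  qed (use f f' in auto)
qed

section \<open>Dihedral groups\<close>

text \<open>
  The dihedral group is the semidirect product of the rotations $\mathbb{Z}/n\mathbb{Z}$ with the
  group of order two acting by negation. The pair $(k, s)$ stands for the rotation $r^k$ if \<open>s\<close> is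
  false, and for the reflection $r^k \sigma$ if \<open>s\<close> is true, with $\sigma r \sigma = r^{-1}$.
  In particular, $D_1$ has order $2$.
\<close>

definition dihedral_group :: "nat \<Rightarrow> (int \<times> bool) monoid" where
  "dihedral_group n =
    \<lparr>carrier = carrier (integer_mod_group n) \<times> UNIV,
     monoid.mult = (\<lambda>(k, s) (l, t). ((if s then k - l else k + l) mod int n, s \<noteq> t)),
     one = (0, False)\<rparr>"

lemma group_dihedral_group: "group (dihedral_group n)"
proof (rule groupI)
  fix x assume x: "x \<in> carrier (dihedral_group n)"
  obtain k s where ks: "x = (k, s)" by (cases x)
  show "\<exists>y\<in>carrier (dihedral_group n). y \<otimes>\<^bsub>dihedral_group n\<^esub> x = \<one>\<^bsub>dihedral_group n\<^esub>"
    using x ks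
    by (intro bexI[of _ "((if s then k else - k) mod int n, s)"])
       (auto simp: dihedral_group_def carrier_integer_mod_group mod_simps split: if_splits)
next
  fix x y z
  assume "x \<in> carrier (dihedral_group n)" "y \<in> carrier (dihedral_group n)"
    "z \<in> carrier (dihedral_group n)"
  then show "x \<otimes>\<^bsub>dihedral_group n\<^esub> y \<otimes>\<^bsub>dihedral_group n\<^esub> z =
    x \<otimes>\<^bsub>dihedral_group n\<^esub> (y \<otimes>\<^bsub>dihedral_group n\<^esub> z)"
    by (cases x; cases y; cases z) (auto simp: dihedral_group_def mod_simps algebra_simps)
qed (auto simp: dihedral_group_def carrier_integer_mod_group split: if_splits)

lemma order_dihedral_group: "n > 0 \<Longrightarrow> order (dihedral_group n) = 2 * n"
  by (simp add: order_def dihedral_group_def carrier_integer_mod_group card_cartesian_product)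

section \<open>Epimorphisms up to automorphisms of source and target\<close>

text \<open>
  As for \<^const>\<open>auto\<close>, maps are taken extensional, so that a homomorphism is determined
  by its values on the carrier.
\<close>

definition Epi :: "('a, 'c) monoid_scheme \<Rightarrow> ('b, 'd) monoid_scheme \<Rightarrow> ('a \<Rightarrow> 'b) set" where
  "Epi F G = epi F G \<inter> extensional (carrier F)"

definition Epi_equiv ::
  "('a, 'c) monoid_scheme \<Rightarrow> ('b, 'd) monoid_scheme \<Rightarrow> (('a \<Rightarrow> 'b) \<times> ('a \<Rightarrow> 'b)) set" where
  "Epi_equiv F G = {(f, f'). f \<in> Epi F G \<and> f' \<in> Epi F G \<and>
     (\<exists>\<phi>\<in>auto F. \<exists>\<psi>\<in>auto G. f' = compose (carrier F) \<psi> (compose (carrier F) f \<phi>))}"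

text \<open>The double quotient $\mathrm{Aut}(G) \backslash \mathrm{Epi}(F, G) / \mathrm{Aut}(F)$.\<close>

definition Aut_Epi_Aut ::
  "('a, 'c) monoid_scheme \<Rightarrow> ('b, 'd) monoid_scheme \<Rightarrow> ('a \<Rightarrow> 'b) set set" where
  "Aut_Epi_Aut F G = Epi F G // Epi_equiv F G"

lemma auto_inverse:
  assumes "group G" "\<phi> \<in> auto G"
  obtains \<phi>' where "\<phi>' \<in> auto G"
    "\<And>x. x \<in> carrier G \<Longrightarrow> \<phi>' (\<phi> x) = x" "\<And>x. x \<in> carrier G \<Longrightarrow> \<phi> (\<phi>' x) = x"
proof
  interpret group G by fact
  have bij: "bij_betw \<phi> (carrier G) (carrier G)"
    using assms by (auto simp: auto_def Bij_def)
  let ?\<phi>' = "restrict (inv_into (carrier G) \<phi>) (carrier G)"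
  show "?\<phi>' \<in> auto G"
    using assms restrict_inv_into_hom restrict_inv_into_Bij by (auto simp: auto_def)
  show "?\<phi>' (\<phi> x) = x" "\<phi> (?\<phi>' x) = x" if "x \<in> carrier G" for x
    using bij that by (auto simp: bij_betw_inv_into_left bij_betw_inv_into_right bij_betwE)
qed

lemma auto_compose:
  "\<lbrakk>group G; \<phi> \<in> auto G; \<psi> \<in> auto G\<rbrakk> \<Longrightarrow> compose (carrier G) \<phi> \<psi> \<in> auto G"
  by (auto simp: auto_def compose_Bij Bij_imp_funcset group.hom_compose)

lemma auto_closed: "\<lbrakk>\<phi> \<in> auto G; x \<in> carrier G\<rbrakk> \<Longrightarrow> \<phi> x \<in> carrier G"
  by (auto simp: auto_def hom_def)

lemma Epi_closed: "\<lbrakk>f \<in> Epi F G; x \<in> carrier F\<rbrakk> \<Longrightarrow> f x \<in> carrier G"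
  by (auto simp: Epi_def epi_def)

lemma Epi_equiv_iff:
  "(f, f') \<in> Epi_equiv F G \<longleftrightarrow> f \<in> Epi F G \<and> f' \<in> Epi F G \<and>
     (\<exists>\<phi>\<in>auto F. \<exists>\<psi>\<in>auto G. \<forall>x\<in>carrier F. f' x = \<psi> (f (\<phi> x)))"
proof -
  have "f' = compose (carrier F) \<psi> (compose (carrier F) f \<phi>) \<longleftrightarrow>
      (\<forall>x\<in>carrier F. f' x = \<psi> (f (\<phi> x)))" if "f' \<in> Epi F G" for \<phi> \<psi>
    using that by (auto simp: Epi_def compose_def extensional_def fun_eq_iff)
  then show ?thesis
    unfolding Epi_equiv_def mem_Collect_eq case_prod_conv by blast
qed

lemma equiv_Epi_equiv:
  assumes "group F" "group G"
  shows "equiv (Epi F G) (Epi_equiv F G)"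
proof (rule equivI)
  interpret F: group F by fact
  interpret G: group G by fact
  show "refl_on (Epi F G) (Epi_equiv F G)"
    by (rule refl_onI)
       (auto simp: Epi_equiv_iff Epi_closed
          intro!: bexI[OF _ F.id_in_auto] bexI[OF _ G.id_in_auto])
  show "Epi_equiv F G \<subseteq> Epi F G \<times> Epi F G"
    by (auto simp: Epi_equiv_def)
  show "sym (Epi_equiv F G)"
  proof (rule symI)
    fix f f' assume "(f, f') \<in> Epi_equiv F G"
    then obtain \<phi> \<psi> where *: "f \<in> Epi F G" "f' \<in> Epi F G" "\<phi> \<in> auto F" "\<psi> \<in> auto G"
      "\<forall>x\<in>carrier F. f' x = \<psi> (f (\<phi> x))"
      by (auto simp: Epi_equiv_iff)
    obtain \<phi>' where \<phi>': "\<phi>' \<in> auto F" "\<And>x. x \<in> carrier F \<Longrightarrow> \<phi> (\<phi>' x) = x"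
      using auto_inverse[OF \<open>group F\<close> *(3)] by metis
    obtain \<psi>' where \<psi>': "\<psi>' \<in> auto G" "\<And>x. x \<in> carrier G \<Longrightarrow> \<psi>' (\<psi> x) = x"
      using auto_inverse[OF \<open>group G\<close> *(4)] by metis
    have "\<forall>x\<in>carrier F. f x = \<psi>' (f' (\<phi>' x))"
      using * \<phi>' \<psi>' by (auto simp: auto_closed Epi_closed)
    then show "(f', f) \<in> Epi_equiv F G"
      using * \<phi>' \<psi>' by (auto simp: Epi_equiv_iff)
  qed
  show "trans (Epi_equiv F G)"
  proof (rule transI)
    fix f g h assume "(f, g) \<in> Epi_equiv F G" "(g, h) \<in> Epi_equiv F G"
    then obtain \<phi> \<psi> \<phi>' \<psi>' where *: "f \<in> Epi F G" "h \<in> Epi F G" "\<phi> \<in> auto F" "\<psi> \<in> auto G"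
      "\<phi>' \<in> auto F" "\<psi>' \<in> auto G"
      "\<forall>x\<in>carrier F. g x = \<psi> (f (\<phi> x))" "\<forall>x\<in>carrier F. h x = \<psi>' (g (\<phi>' x))"
      by (auto simp: Epi_equiv_iff)
    have "\<forall>x\<in>carrier F. h x =
        compose (carrier G) \<psi>' \<psi> (f (compose (carrier F) \<phi> \<phi>' x))"
      using * by (auto simp: compose_eq auto_closed Epi_closed)
    then show "(f, h) \<in> Epi_equiv F G"
      using * auto_compose[OF \<open>group F\<close>] auto_compose[OF \<open>group G\<close>]
      unfolding Epi_equiv_iff by blast
  qed
qed

lemma card_Aut_Epi_Aut_eq_1_iff:
  assumes "group F" "group G"
  shows "card (Aut_Epi_Aut F G) = 1 \<longleftrightarrow> Epi F G \<noteq> {} \<and>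
    (\<forall>f\<in>Epi F G. \<forall>f'\<in>Epi F G. \<exists>\<phi>\<in>auto F. \<exists>\<psi>\<in>auto G. \<forall>x\<in>carrier F. f' x = \<psi> (f (\<phi> x)))"
    (is "_ \<longleftrightarrow> _ \<and> ?T")
proof -
  note eq = equiv_Epi_equiv[OF assms]
  have T: "?T \<longleftrightarrow> (\<forall>f\<in>Epi F G. \<forall>f'\<in>Epi F G. (f, f') \<in> Epi_equiv F G)"
    by (auto simp: Epi_equiv_iff)
  show ?thesis
  proof
    assume "card (Aut_Epi_Aut F G) = 1"
    then obtain C where C: "Epi F G // Epi_equiv F G = {C}"
      by (auto simp: Aut_Epi_Aut_def card_1_singleton_iff)
    have cls: "Epi_equiv F G `` {f} = C" if "f \<in> Epi F G" for f
      using quotientI[OF that, of "Epi_equiv F G"] C by auto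
    have "Epi F G \<noteq> {}"
      using C by (auto simp: quotient_def)
    moreover have "(f, f') \<in> Epi_equiv F G" if "f \<in> Epi F G" "f' \<in> Epi F G" for f f'
      using cls[OF that(1)] cls[OF that(2)] eq_equiv_class[OF _ eq that(2)] by metis
    ultimately show "Epi F G \<noteq> {} \<and> ?T"
      unfolding T by blast
  next
    assume *: "Epi F G \<noteq> {} \<and> ?T"
    then have "Epi_equiv F G `` {f} = Epi F G" if "f \<in> Epi F G" for f
      using that unfolding T by (auto simp: Epi_equiv_def)
    with * have "Epi F G // Epi_equiv F G = {Epi F G}"
      by (auto simp: quotient_def)
    then show "card (Aut_Epi_Aut F G) = 1"
      by (simp add: Aut_Epi_Aut_def)
  qed
qed

end

theory Submission
  imports Defs "HOL-Number_Theory.Cong"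
begin

text \<open>
  Epimorphisms from the free group are generating pairs \<open>(a, b)\<close>, on which automorphisms of the free
  group act by Nielsen moves. The Euclidean algorithm on the cyclic components makes the cyclic
  component of \<open>b\<close> trivial. If \<open>b\<close> is then a rotation, \<open>a\<close> is a reflection and \<open>m\<close> must be odd, since
  for even \<open>m\<close> the pair would lie in a subgroup of index two; so replacing \<open>b\<close> by \<open>b a\<^sup>-\<^sup>m\<close> turns it into
  a reflection without changing its cyclic component. If \<open>a\<close> is now a reflection, \<open>a b\<^sup>-\<^sup>1\<close> is a
  rotation. Since the pair generates, both components of \<open>a\<close> are units, and an automorphism of the
  target carries the pair to \<open>((r, 1), (\<sigma>, 0))\<close>. That this last pair generates uses that \<open>n\<close> is odd.
\<close>

section \<open>Nielsen moves\<close>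

abbreviation gen_x :: "letter list" where "gen_x \<equiv> [(generator.X, True)]"
abbreviation gen_y :: "letter list" where "gen_y \<equiv> [(Y, True)]"

lemma gen_in_F2 [simp]: "[l] \<in> carrier F2"
  by (simp add: F2_def)

text \<open>Uniqueness in the universal property. It speaks of extensional maps, so the restrictions
  of \<open>f\<close> and \<open>h\<close> to the carrier are compared.\<close>

lemma F2_hom_ext:
  assumes "group G" "f \<in> hom F2 G" "h \<in> hom F2 G"
    and xy: "f gen_x = h gen_x" "f gen_y = h gen_y" and w: "w \<in> carrier F2"
  shows "f w = h w"
proof -
  have "f [(z, True)] = h [(z, True)]" for z
    using xy by (cases z) auto
  moreover have "h [(z, True)] \<in> carrier G" for z
    using assms(3) by (auto simp: hom_def)
  ultimately have "restrict f (carrier F2) = restrict h (carrier F2)"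
    using F2_universal_property[OF assms(1), of "\<lambda>z. h [(z, True)]"] assms(2,3)
      group.hom_restrict[OF group_F2 assms(2), of "restrict f (carrier F2)"]
      group.hom_restrict[OF group_F2 assms(3), of "restrict h (carrier F2)"]
    by (metis (no_types, lifting) Int_iff gen_in_F2 restrict_apply' restrict_extensional)
  then show ?thesis
    using w by (metis restrict_apply')
qed

lemma F2_hom_obtain:
  assumes "group G" "a \<in> carrier G" "b \<in> carrier G"
  obtains h where "h \<in> hom F2 G" "h \<in> extensional (carrier F2)" "h gen_x = a" "h gen_y = b"
proof -
  have "\<And>z. case_generator a b z \<in> carrier G"
    using assms by (simp split: generator.split)
  then show thesis
    using F2_universal_property[OF assms(1), of "case_generator a b"] that by auto
qed

text \<open>The universal property with target \<open>H\<close> gives a homomorphism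
  \<open>k\<close> into \<open>H\<close> with the same values on the generators; by uniqueness it
  agrees with \<open>h\<close>.\<close>

lemma F2_hom_image_subgroup:
  assumes "group G" "subgroup H G" "h \<in> hom F2 G" "h gen_x \<in> H" "h gen_y \<in> H"
    and w: "w \<in> carrier F2"
  shows "h w \<in> H"
proof -
  interpret group G by fact
  obtain k where k: "k \<in> hom F2 (G\<lparr>carrier := H\<rparr>)" "k gen_x = h gen_x" "k gen_y = h gen_y"
    using F2_hom_obtain[of "G\<lparr>carrier := H\<rparr>" "h gen_x" "h gen_y"] assms
    by (auto simp: subgroup.subgroup_is_group)
  have "k \<in> hom F2 G"
    using k(1) subgroup.subset[OF assms(2)] by (auto simp: hom_def)
  then have "h w = k w"
    using F2_hom_ext[OF assms(1,3)] k(2,3) w by metis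
  then show ?thesis
    using k(1) w by (auto simp: hom_def)
qed

text \<open>Both composites are endomorphisms fixing the generators, hence identities on the
  carrier, so an inverse has to be checked on two words only.\<close>

lemma F2_auto_of_inverse:
  assumes "\<phi> \<in> hom F2 F2" "\<phi> \<in> extensional (carrier F2)" "\<theta> \<in> hom F2 F2"
    and "\<phi> (\<theta> gen_x) = gen_x" "\<phi> (\<theta> gen_y) = gen_y"
    and "\<theta> (\<phi> gen_x) = gen_x" "\<theta> (\<phi> gen_y) = gen_y"
  shows "\<phi> \<in> auto F2"
proof -
  have id: "(\<lambda>w. w) \<in> hom F2 F2" by (simp add: hom_def)
  have "(\<phi> \<circ> \<theta>) w = w" if "w \<in> carrier F2" for w
    by (rule F2_hom_ext[OF group_F2 Group.hom_compose[OF assms(3,1)] id])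
       (use assms that in simp_all)
  moreover have "(\<theta> \<circ> \<phi>) w = w" if "w \<in> carrier F2" for w
    by (rule F2_hom_ext[OF group_F2 Group.hom_compose[OF assms(1,3)] id])
       (use assms that in simp_all)
  ultimately have "bij_betw \<phi> (carrier F2) (carrier F2)"
    using assms(1,3) by (intro bij_betw_byWitness[where f' = \<theta>]) (auto simp: hom_def)
  then show ?thesis
    using assms by (auto simp: auto_def Bij_def)
qed

text \<open>The swap is its own inverse, so it serves as both maps in
  \<open>F2_auto_of_inverse\<close>.\<close>

lemma auto_F2_swap:
  obtains \<phi> where "\<phi> \<in> auto F2" "\<phi> gen_x = gen_y" "\<phi> gen_y = gen_x"
proof -
  obtain \<phi> where "\<phi> \<in> hom F2 F2" "\<phi> \<in> extensional (carrier F2)" "\<phi> gen_x = gen_y" "\<phi> gen_y = gen_x"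
    by (rule F2_hom_obtain[OF group_F2, of gen_y gen_x]) auto
  then show thesis
    using F2_auto_of_inverse that by metis
qed

lemma auto_F2_transvection:
  obtains \<phi> where "\<phi> \<in> auto F2" "\<phi> gen_x = gen_x \<otimes>\<^bsub>F2\<^esub> inv\<^bsub>F2\<^esub> gen_y" "\<phi> gen_y = gen_y"
proof -
  interpret group F2 by (rule group_F2)
  obtain \<phi> where \<phi>: "\<phi> \<in> hom F2 F2" "\<phi> \<in> extensional (carrier F2)"
      "\<phi> gen_x = gen_x \<otimes>\<^bsub>F2\<^esub> inv\<^bsub>F2\<^esub> gen_y" "\<phi> gen_y = gen_y"
    by (rule F2_hom_obtain[OF group_F2, of "gen_x \<otimes>\<^bsub>F2\<^esub> inv\<^bsub>F2\<^esub> gen_y" gen_y]) auto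
  \<comment> \<open>The inverse transvection, sending x to x y and fixing y.\<close>
  obtain \<theta> where \<theta>: "\<theta> \<in> hom F2 F2" "\<theta> gen_x = gen_x \<otimes>\<^bsub>F2\<^esub> gen_y" "\<theta> gen_y = gen_y"
    by (rule F2_hom_obtain[OF group_F2, of "gen_x \<otimes>\<^bsub>F2\<^esub> gen_y" gen_y]) auto
  interpret \<phi>: group_hom F2 F2 \<phi> by unfold_locales (rule \<phi>)
  interpret \<theta>: group_hom F2 F2 \<theta> by unfold_locales (rule \<theta>)
  have "\<phi> \<in> auto F2"
    by (rule F2_auto_of_inverse[of _ \<theta>]) (use \<phi> \<theta> in \<open>auto simp: m_assoc\<close>)
  with \<phi> that show thesis by blast
qed

section \<open>Orbits of generating pairs\<close>

lemma Epi_equiv_compose: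
  assumes "group F" "f \<in> Epi F G" "\<phi> \<in> auto F" "\<psi> \<in> auto G"
  shows "(f, compose (carrier F) \<psi> (compose (carrier F) f \<phi>)) \<in> Epi_equiv F G"
proof -
  have im: "\<phi> ` carrier F = carrier F" "\<psi> ` carrier G = carrier G" "f ` carrier F = carrier G"
    using assms by (auto simp: auto_def Bij_def Epi_def epi_def bij_betw_def)
  let ?h = "\<lambda>w. \<psi> (f (\<phi> w))"
  have "?h ` carrier F = carrier G"
    using im by (metis image_image)
  moreover have "?h \<in> hom F G"
    using assms by (auto simp: hom_def auto_def Epi_def epi_def Pi_iff)
  moreover have "compose (carrier F) \<psi> (compose (carrier F) f \<phi>) = restrict ?h (carrier F)"
    by (auto simp: compose_def)
  ultimately have "compose (carrier F) \<psi> (compose (carrier F) f \<phi>) \<in> Epi F G"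
    using group.hom_restrict[OF assms(1), of ?h G "restrict ?h (carrier F)"]
    by (auto simp: Epi_def epi_def)
  with assms show ?thesis
    by (auto simp: Epi_equiv_def)
qed

text \<open>The class of \<open>f\<close>, recorded by generator values. Nothing is lost, since an
  epimorphism from the free group is determined by these two values.\<close>

definition pair_orbit :: "('a, 'b) monoid_scheme \<Rightarrow> (letter list \<Rightarrow> 'a) \<Rightarrow> ('a \<times> 'a) set" where
  "pair_orbit G f = (\<lambda>h. (h gen_x, h gen_y)) ` (Epi_equiv F2 G `` {f})"

lemma pair_orbitE:
  assumes "(a, b) \<in> pair_orbit G f"
  obtains h where "(f, h) \<in> Epi_equiv F2 G" "h \<in> Epi F2 G" "h gen_x = a" "h gen_y = b"
proof -
  obtain h where h: "(f, h) \<in> Epi_equiv F2 G" "h gen_x = a" "h gen_y = b"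
    using assms by (auto simp: pair_orbit_def)
  moreover have "h \<in> Epi F2 G"
    using h by (simp add: Epi_equiv_iff)
  ultimately show thesis
    using that by blast
qed

context
  fixes G :: "('a, 'b) monoid_scheme" (structure) and f :: "letter list \<Rightarrow> 'a"
  assumes G: "group G"
begin

lemma pair_orbit_refl: "f \<in> Epi F2 G \<Longrightarrow> (f gen_x, f gen_y) \<in> pair_orbit G f"
  using equiv_Epi_equiv[OF group_F2 G] by (auto simp: pair_orbit_def equiv_def refl_on_def)

lemma pair_orbit_closed:
  "(a, b) \<in> pair_orbit G f \<Longrightarrow> a \<in> carrier G \<and> b \<in> carrier G"
  by (auto elim!: pair_orbitE intro: Epi_closed)

text \<open>Only the generator values of \<open>h\<close> are known to come from the class of
  \<open>f\<close>. They belong to some member \<open>k\<close>, which agrees with \<open>h\<close>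
  on the whole carrier, so acting on \<open>k\<close> is acting on \<open>h\<close>.\<close>

lemma pair_orbit_act:
  assumes "(h gen_x, h gen_y) \<in> pair_orbit G f" "h \<in> Epi F2 G" "\<phi> \<in> auto F2" "\<psi> \<in> auto G"
  shows "(\<psi> (h (\<phi> gen_x)), \<psi> (h (\<phi> gen_y))) \<in> pair_orbit G f"
proof -
  obtain k where k: "(f, k) \<in> Epi_equiv F2 G" "k \<in> Epi F2 G" "k gen_x = h gen_x" "k gen_y = h gen_y"
    by (rule pair_orbitE[OF assms(1)])
  have hom: "k \<in> hom F2 G" "h \<in> hom F2 G"
    using k assms by (auto simp: Epi_def epi_def)
  have kh: "k w = h w" if "w \<in> carrier F2" for w
    using F2_hom_ext[OF G hom k(3,4) that] .
  let ?l = "compose (carrier F2) \<psi> (compose (carrier F2) k \<phi>)"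
  have "(f, ?l) \<in> Epi_equiv F2 G"
    using Epi_equiv_compose[OF group_F2 k(2) assms(3,4)] k(1) equiv_Epi_equiv[OF group_F2 G]
    by (meson equivE transD)
  moreover have "?l gen_x = \<psi> (h (\<phi> gen_x))" "?l gen_y = \<psi> (h (\<phi> gen_y))"
    using kh auto_closed[OF assms(3)] by (simp_all add: compose_def)
  ultimately show ?thesis
    unfolding pair_orbit_def by (intro image_eqI[where x = ?l]) simp_all
qed

lemma pair_orbit_auto:
  assumes "(a, b) \<in> pair_orbit G f" "\<psi> \<in> auto G"
  shows "(\<psi> a, \<psi> b) \<in> pair_orbit G f"
proof -
  obtain h where h: "h \<in> Epi F2 G" "h gen_x = a" "h gen_y = b"
    by (rule pair_orbitE[OF assms(1)])
  then show ?thesis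
    using pair_orbit_act[OF _ h(1) group.id_in_auto[OF group_F2] assms(2)] assms(1) by simp
qed

lemma pair_orbit_swap:
  assumes "(a, b) \<in> pair_orbit G f"
  shows "(b, a) \<in> pair_orbit G f"
proof -
  obtain h where h: "h \<in> Epi F2 G" "h gen_x = a" "h gen_y = b"
    by (rule pair_orbitE[OF assms])
  obtain \<phi> where \<phi>: "\<phi> \<in> auto F2" "\<phi> gen_x = gen_y" "\<phi> gen_y = gen_x"
    by (rule auto_F2_swap)
  show ?thesis
    using pair_orbit_act[OF _ h(1) \<phi>(1) group.id_in_auto[OF G]] h \<phi> assms pair_orbit_closed
    by auto
qed

text \<open>The Nielsen move replacing \<open>a\<close> by a b^-1, with this quotient given through
  the factorization of \<open>a\<close>.\<close>

lemma pair_orbit_cancel: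
  assumes "(a, b) \<in> pair_orbit G f" "c \<in> carrier G" "a = c \<otimes> b"
  shows "(c, b) \<in> pair_orbit G f"
proof -
  interpret group G by (rule G)
  interpret F: group F2 by (rule group_F2)
  obtain h where h: "h \<in> Epi F2 G" "h gen_x = a" "h gen_y = b"
    by (rule pair_orbitE[OF assms(1)])
  interpret h: group_hom F2 G h
    using h by unfold_locales (auto simp: Epi_def epi_def)
  obtain \<phi> where \<phi>: "\<phi> \<in> auto F2" "\<phi> gen_x = gen_x \<otimes>\<^bsub>F2\<^esub> inv\<^bsub>F2\<^esub> gen_y" "\<phi> gen_y = gen_y"
    by (rule auto_F2_transvection)
  have b: "b \<in> carrier G"
    using assms(1) pair_orbit_closed by blast
  have "h (\<phi> gen_x) = c"
    using h \<phi> assms b by (simp add: m_assoc)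
  then show ?thesis
    using pair_orbit_act[OF _ h(1) \<phi>(1) id_in_auto] h \<phi> assms b by simp
qed

text \<open>The source of all obstructions below: no proper subgroup contains both entries of a pair
  in the orbit.\<close>

lemma pair_orbit_generates:
  assumes "(a, b) \<in> pair_orbit G f" "subgroup H G" "a \<in> H" "b \<in> H"
  shows "carrier G \<subseteq> H"
proof -
  obtain h where h: "h \<in> Epi F2 G" "h gen_x = a" "h gen_y = b"
    by (rule pair_orbitE[OF assms(1)])
  then have hom: "h \<in> hom F2 G" and "carrier G = h ` carrier F2"
    by (auto simp: Epi_def epi_def)
  then show ?thesis
    using F2_hom_image_subgroup[OF G assms(2) hom] h assms(3,4) by (simp add: image_subset_iff)
qed

lemma Epi_equiv_if_pair_orbit:
  assumes "(h gen_x, h gen_y) \<in> pair_orbit G f" "h \<in> Epi F2 G"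
  shows "(f, h) \<in> Epi_equiv F2 G"
proof -
  obtain k where k: "(f, k) \<in> Epi_equiv F2 G" "k \<in> Epi F2 G" "k gen_x = h gen_x" "k gen_y = h gen_y"
    by (rule pair_orbitE[OF assms(1)])
  have "k w = h w" if "w \<in> carrier F2" for w
    using k assms F2_hom_ext[OF G _ _ k(3,4) that] by (auto simp: Epi_def epi_def)
  then have "k = h"
    using k(2) assms(2) by (auto simp: Epi_def intro: extensionalityI)
  with k show ?thesis by simp
qed

end

section \<open>The product of a dihedral and a cyclic group\<close>

abbreviation dihedral_cyclic :: "nat \<Rightarrow> nat \<Rightarrow> ((int \<times> bool) \<times> int) monoid" where
  "dihedral_cyclic n m \<equiv> dihedral_group n \<times>\<times> integer_mod_group m"

lemma mult_dihedral_cyclic: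
  "((k, s), z) \<otimes>\<^bsub>dihedral_cyclic n m\<^esub> ((l, t), w) =
    (((if s then k - l else k + l) mod int n, s \<noteq> t), (z + w) mod int m)"
  by (simp add: dihedral_group_def)

lemma one_dihedral_cyclic: "\<one>\<^bsub>dihedral_cyclic n m\<^esub> = ((0, False), 0)"
  by (simp add: dihedral_group_def)

lemma group_dihedral_cyclic: "group (dihedral_cyclic n m)"
  by (simp add: DirProd_group group_dihedral_group)

declare carrier_DirProd [simp del] mult_DirProd [simp del] one_DirProd [simp del]

context
  fixes n m :: nat
  assumes n: "n > 0" and m: "m > 0"
begin

interpretation G: group "dihedral_cyclic n m"
  by (rule group_dihedral_cyclic)

lemma carrier_dihedral_cyclic:
  "((k, s), z) \<in> carrier (dihedral_cyclic n m) \<longleftrightarrow> 0 \<le> k \<and> k < int n \<and> 0 \<le> z \<and> z < int m"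
  using n m by (auto simp: dihedral_group_def carrier_integer_mod_group carrier_DirProd)

lemma inv_dihedral_cyclic:
  assumes "((k, s), z) \<in> carrier (dihedral_cyclic n m)"
  shows "inv\<^bsub>dihedral_cyclic n m\<^esub> ((k, s), z) =
    (((if s then k else - k) mod int n, s), (- z) mod int m)"
  using assms n m
  by (intro G.inv_equality)
     (auto simp: carrier_dihedral_cyclic mult_dihedral_cyclic one_dihedral_cyclic mod_simps)

section \<open>Subgroups and automorphisms of the product\<close>

lemma subgroup_dihedral_cyclicI:
  assumes "P 0 False 0"
    and "\<And>k s z l t w. \<lbrakk>P k s z; P l t w\<rbrakk> \<Longrightarrow>
      P ((if s then k - l else k + l) mod int n) (s \<noteq> t) ((z + w) mod int m)"
    and "\<And>k s z. P k s z \<Longrightarrow> P ((if s then k else - k) mod int n) s ((- z) mod int m)"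
  shows "subgroup {x \<in> carrier (dihedral_cyclic n m). P (fst (fst x)) (snd (fst x)) (snd x)}
    (dihedral_cyclic n m)" (is "subgroup ?H _")
proof (rule G.subgroupI)
  have "((0, False), 0) \<in> ?H"
    using n m assms(1) by (simp add: carrier_dihedral_cyclic)
  then show "?H \<noteq> {}" by blast
next
  fix a assume "a \<in> ?H"
  then obtain k s z where a: "a = ((k, s), z)" "((k, s), z) \<in> carrier (dihedral_cyclic n m)" "P k s z"
    by (cases a; cases "fst a") auto
  have "inv\<^bsub>dihedral_cyclic n m\<^esub> a \<in> carrier (dihedral_cyclic n m)"
    using a by blast
  with a assms(3)[OF a(3)] show "inv\<^bsub>dihedral_cyclic n m\<^esub> a \<in> ?H"
    by (simp add: inv_dihedral_cyclic)
next
  fix a b assume "a \<in> ?H" "b \<in> ?H"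
  then obtain k s z l t w where
    a: "a = ((k, s), z)" "((k, s), z) \<in> carrier (dihedral_cyclic n m)" "P k s z" and
    b: "b = ((l, t), w)" "((l, t), w) \<in> carrier (dihedral_cyclic n m)" "P l t w"
    by (cases a; cases "fst a"; cases b; cases "fst b") auto
  have "a \<otimes>\<^bsub>dihedral_cyclic n m\<^esub> b \<in> carrier (dihedral_cyclic n m)"
    using a b by blast
  with a b assms(2)[OF a(3) b(3)] show "a \<otimes>\<^bsub>dihedral_cyclic n m\<^esub> b \<in> ?H"
    by (simp add: mult_dihedral_cyclic)
qed blast

text \<open>As \<open>g\<close> divides \<open>m\<close>, divisibility by \<open>g\<close> survives
  reduction modulo \<open>m\<close>.\<close>

lemma subgroup_dvd_cyclic:
  assumes "g dvd int m"
  shows "subgroup {x \<in> carrier (dihedral_cyclic n m). g dvd snd x}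
    (dihedral_cyclic n m)"
  by (rule subgroup_dihedral_cyclicI[where P = "\<lambda>k s z. g dvd z"]) (auto simp: dvd_mod_iff[OF assms])

text \<open>Reducing rotations modulo \<open>g\<close> maps the group to the dihedral group of order
  2g; this is the preimage of the subgroup consisting of 1 and the reflection r^c \<sigma>.\<close>

lemma subgroup_dvd_rotation:
  assumes "g dvd int n"
  shows "subgroup {x \<in> carrier (dihedral_cyclic n m).
      [fst (fst x) = (if snd (fst x) then c else 0)] (mod g)} (dihedral_cyclic n m)"
proof (rule subgroup_dihedral_cyclicI[where P = "\<lambda>k s z. [k = (if s then c else 0)] (mod g)"])
  have *: "[a mod int n = b] (mod g) \<longleftrightarrow> [a = b] (mod g)" for a b
    using assms by (simp add: cong_def mod_mod_cancel)
  show "[(if s then k - l else k + l) mod int n = (if s \<noteq> t then c else 0)] (mod g)"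
    if "[k = (if s then c else 0)] (mod g)" "[l = (if t then c else 0)] (mod g)" for k s l t
    using cong_add[OF that] cong_diff[OF that] by (auto simp: * split: if_splits)
  show "[(if s then k else - k) mod int n = (if s then c else 0)] (mod g)"
    if "[k = (if s then c else 0)] (mod g)" for k s
    using that cong_minus_minus_iff[of k 0 g] by (auto simp: * split: if_splits)
qed auto

text \<open>For even \<open>m\<close> the parity of the cyclic component is a homomorphism to Z/2.
  Adding it to the reflection flag gives another one, whose kernel this is.\<close>

lemma subgroup_parity:
  assumes "even m"
  shows "subgroup {x \<in> carrier (dihedral_cyclic n m). snd (fst x) = odd (snd x)}
    (dihedral_cyclic n m)"
proof -
  have "2 dvd int m" using assms by simp
  note * = dvd_mod_iff[OF this]
  show ?thesis
    by (rule subgroup_dihedral_cyclicI[where P = "\<lambda>k s z. s = odd z"]) (auto simp: *)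
qed

lemma mod_affine: "(p * (x mod k) + c) mod k = (p * x + c) mod k" for p x c k :: int
  by (metis mod_add_left_eq mod_mult_right_eq)

text \<open>The map sends r to r^p and \<sigma> to r^c \<sigma>, and multiplies the cyclic factor by
  \<open>v\<close>. Cancelling the units \<open>p\<close> and \<open>v\<close> gives injectivity;
  finiteness then gives surjectivity.\<close>

lemma auto_dihedral_cyclic:
  fixes c :: int
  assumes p: "coprime p (int n)" and v: "coprime v (int m)"
  defines "\<psi> \<equiv> \<lambda>((j, s), z). (((p * j + (if s then c else 0)) mod int n, s), (v * z) mod int m)"
  shows "restrict \<psi> (carrier (dihedral_cyclic n m)) \<in> auto (dihedral_cyclic n m)"
proof -
  let ?C = "carrier (dihedral_cyclic n m)"
  have maps: "\<psi> ` ?C \<subseteq> ?C"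
    using n m by (auto simp: \<psi>_def carrier_dihedral_cyclic)
  have "inj_on \<psi> ?C"
  proof (rule inj_onI)
    fix a b assume ab: "a \<in> ?C" "b \<in> ?C" "\<psi> a = \<psi> b"
    obtain k s z l t w where a: "a = ((k, s), z)" and b: "b = ((l, t), w)"
      by (metis surj_pair)
    have "s = t" "[p * k = p * l] (mod int n)" "[v * z = v * w] (mod int m)"
      using ab(3) cong_add_rcancel[of "p * k" _ "p * l" "int n"]
      by (auto simp: \<psi>_def a b cong_def[symmetric] split: if_splits)
    then have "s = t" "[k = l] (mod int n)" "[z = w] (mod int m)"
      using p v by (simp_all add: cong_mult_lcancel)
    then show "a = b"
      using ab(1,2) by (auto simp: a b carrier_dihedral_cyclic cong_def)
  qed
  moreover have "finite ?C"
    using n m by (simp add: dihedral_group_def carrier_integer_mod_group carrier_DirProd)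
  ultimately have "bij_betw \<psi> ?C ?C"
    using maps by (simp add: bij_betw_def endo_inj_surj)
  moreover have "\<psi> (a \<otimes>\<^bsub>dihedral_cyclic n m\<^esub> b) = \<psi> a \<otimes>\<^bsub>dihedral_cyclic n m\<^esub> \<psi> b" for a b
    by (cases a; cases b)
       (auto simp: \<psi>_def mult_dihedral_cyclic mod_simps mod_affine; simp add: algebra_simps)
  ultimately show ?thesis
    using maps by (auto simp: auto_def Bij_def hom_def image_subset_iff)
qed

section \<open>The standard generating pair\<close>

text \<open>Conjugating (r, 1) by (\<sigma>, 0) gives (r^-1, 1). The products of powers of these two
  are (r^(p-q), p+q), which exhaust the rotations with arbitrary cyclic component; multiplying by
  (\<sigma>, 0) adds the reflections.\<close>

lemma std_pair_Epi:
  assumes "odd n"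
  obtains h where "h \<in> Epi F2 (dihedral_cyclic n m)"
    "h gen_x = ((1 mod int n, False), 1 mod int m)" "h gen_y = ((0, True), 0)"
proof -
  let ?G = "dihedral_cyclic n m"
  let ?a = "((1 mod int n, False), 1 mod int m)" and ?b = "((0, True), 0)"
  let ?c = "(((- 1) mod int n, False), 1 mod int m)"
  have ab: "?a \<in> carrier ?G" "?b \<in> carrier ?G" "?c \<in> carrier ?G"
    using n m by (auto simp: carrier_dihedral_cyclic)
  obtain h where h: "h \<in> hom F2 ?G" "h \<in> extensional (carrier F2)" "h gen_x = ?a" "h gen_y = ?b"
    by (rule F2_hom_obtain[OF group_dihedral_cyclic ab(1,2)])
  interpret h: group_hom F2 ?G h
    using group_F2 h by (simp add: group_hom_def group_hom_axioms_def group_dihedral_cyclic)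
  let ?H = "h ` carrier F2"
  interpret H: subgroup ?H ?G
    by (rule h.img_is_subgroup)
  have a: "?a \<in> ?H" and b: "?b \<in> ?H"
    using h gen_in_F2 by (metis imageI)+
  have "?c = ?b \<otimes>\<^bsub>?G\<^esub> ?a \<otimes>\<^bsub>?G\<^esub> ?b"
    by (simp add: mult_dihedral_cyclic mod_simps)
  then have c: "?c \<in> ?H"
    using a b by simp
  have pow_a: "?a [^]\<^bsub>?G\<^esub> p = ((int p mod int n, False), int p mod int m)" for p :: nat
    by (induction p) (simp_all add: one_dihedral_cyclic mult_dihedral_cyclic mod_simps algebra_simps)
  have pow_c: "?c [^]\<^bsub>?G\<^esub> p = (((- int p) mod int n, False), int p mod int m)" for p :: nat
    by (induction p) (simp_all add: one_dihedral_cyclic mult_dihedral_cyclic mod_simps algebra_simps)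
  have pow_H: "x [^]\<^bsub>?G\<^esub> p \<in> ?H" if "x \<in> ?H" for x and p :: nat
    using that by (induction p) auto
  have rot: "((j, False), z) \<in> ?H" if jz: "((j, False), z) \<in> carrier ?G" for j z
  proof -
    have bounds: "0 \<le> j" "j < int n" "0 \<le> z" "z < int m"
      using jz by (auto simp: carrier_dihedral_cyclic)
    \<comment> \<open>Solve \<open>p - q = j\<close> modulo \<open>n\<close> and \<open>p + q = z\<close> modulo \<open>m\<close>; \<open>t\<close> repairs the parity, as \<open>n\<close> is odd.\<close>
    define t where "t = (z - j) mod 2 * int n"
    define q where "q = (z - j - t) div 2 + int n * int m"
    have "even (z - j - t)"
      using \<open>odd n\<close> by (auto simp: t_def even_mod_2_iff)
    then have q2: "2 * q = z - j - t + 2 * (int n * int m)"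
      by (simp add: q_def)
    \<comment> \<open>The summand \<open>int n * int m\<close> of \<open>q\<close> makes both
      exponents nonnegative, so that natural powers suffice; it cancels in p - q and vanishes modulo
      \<open>m\<close> in p + q.\<close>
    have "t \<le> int n" "0 \<le> t"
      using n by (auto simp: t_def mult_le_cancel_right1)
    moreover have "int n \<le> int n * int m"
      using n m by (simp add: mult_le_cancel_left1)
    ultimately have nonneg: "0 \<le> q" "0 \<le> q + j + t"
      using bounds q2 by linarith+
    have "?a [^]\<^bsub>?G\<^esub> nat (q + j + t) \<otimes>\<^bsub>?G\<^esub> ?c [^]\<^bsub>?G\<^esub> nat q =
        (((q + j + t + - q) mod int n, False), (q + j + t + q) mod int m)"
      using nonneg by (simp only: pow_a pow_c mult_dihedral_cyclic mod_add_eq if_False simp_thms int_nat_eq if_True)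
    also have "\<dots> = (((j + t) mod int n, False), (z + 2 * (int n * int m)) mod int m)"
    proof -
      have "q + j + t + - q = j + t" "q + j + t + q = z + 2 * (int n * int m)"
        using q2 by linarith+
      then show ?thesis by (simp only:)
    qed
    also have "\<dots> = ((j, False), z)"
      using bounds by (simp add: t_def mult.assoc[symmetric])
    finally show ?thesis
      using pow_H[OF a, of "nat (q + j + t)"] pow_H[OF c, of "nat q"] by (metis H.m_closed)
  qed
  have "carrier ?G \<subseteq> ?H"
  proof
    fix x assume x: "x \<in> carrier ?G"
    obtain j s z where jsz: "x = ((j, s), z)" by (metis surj_pair)
    have r: "((j, False), z) \<in> ?H"
      using x by (intro rot) (simp add: jsz carrier_dihedral_cyclic)
    have "x = ((j, False), z) \<otimes>\<^bsub>?G\<^esub> ?b" if s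
      using x that by (simp add: jsz carrier_dihedral_cyclic mult_dihedral_cyclic)
    then show "x \<in> ?H"
      using r b H.m_closed[OF r b] jsz by (cases s) auto
  qed
  then have "h \<in> Epi F2 ?G"
    using h H.subset by (auto simp: Epi_def epi_def)
  with h that show thesis by blast
qed

section \<open>Reduction of an arbitrary pair to the standard one\<close>

text \<open>Only the reflection flag and the cyclic component of the quotient are tracked; the
  reduction never looks at its rotation exponent.\<close>

lemma pair_orbit_divide:
  assumes "(a, b) \<in> pair_orbit (dihedral_cyclic n m) f"
  obtains c where "(c, b) \<in> pair_orbit (dihedral_cyclic n m) f"
    "snd (fst c) = (snd (fst a) \<noteq> snd (fst b))" "snd c = (snd a - snd b) mod int m"
proof -
  let ?G = "dihedral_cyclic n m"
  have ab: "a \<in> carrier ?G" "b \<in> carrier ?G"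
    using pair_orbit_closed[OF group_dihedral_cyclic assms] by auto
  define c where "c = a \<otimes>\<^bsub>?G\<^esub> inv\<^bsub>?G\<^esub> b"
  obtain k s z l t w where a: "a = ((k, s), z)" and b: "b = ((l, t), w)"
    by (metis surj_pair)
  have "(c, b) \<in> pair_orbit ?G f"
    by (rule pair_orbit_cancel[OF group_dihedral_cyclic assms])
       (use ab in \<open>auto simp: c_def G.m_assoc\<close>)
  moreover have "snd (fst c) = (s \<noteq> t)" "snd c = (z - w) mod int m"
    using ab by (simp_all add: c_def a b inv_dihedral_cyclic mult_dihedral_cyclic mod_simps)
  ultimately show thesis
    using that by (simp add: a b)
qed

text \<open>Subtractive Euclidean algorithm on the representatives in 0..m-1: subtracting the
  smaller nonzero component from the larger lowers their sum.\<close>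

lemma pair_orbit_euclid:
  assumes "(a, b) \<in> pair_orbit (dihedral_cyclic n m) f"
  shows "\<exists>a b. (a, b) \<in> pair_orbit (dihedral_cyclic n m) f \<and> snd b = 0"
  using assms
proof (induction "nat (snd a + snd b)" arbitrary: a b rule: less_induct)
  case less
  have bounds: "0 \<le> snd x \<and> snd x < int m" if "x \<in> carrier (dihedral_cyclic n m)" for x
    using that by (cases x; cases "fst x") (auto simp: carrier_dihedral_cyclic)
  note swap = pair_orbit_swap[OF group_dihedral_cyclic]
  have sub: ?case
    if ab: "(a', b') \<in> pair_orbit (dihedral_cyclic n m) f" "snd a' + snd b' = snd a + snd b"
      "snd b' \<noteq> 0" "snd b' \<le> snd a'" for a' b'
  proof -
    have bd: "0 \<le> snd a'" "snd a' < int m" "0 \<le> snd b'" 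
      using pair_orbit_closed[OF group_dihedral_cyclic ab(1)] bounds by auto
    obtain c where c: "(c, b') \<in> pair_orbit (dihedral_cyclic n m) f"
        "snd c = (snd a' - snd b') mod int m"
      by (rule pair_orbit_divide[OF ab(1)])
    \<comment> \<open>The difference already lies between 0 and m-1, so reduction modulo
      \<open>m\<close> does nothing.\<close>
    have "snd c = snd a' - snd b'"
      using c(2) bd ab(4) by simp
    then show ?thesis
      using less.hyps[OF _ c(1)] ab bd by simp
  qed
  show ?case
  proof (cases "snd a = 0 \<or> snd b = 0")
    case True
    then show ?thesis using less.prems swap by blast
  next
    case False
    then show ?thesis
      using sub[OF less.prems] sub[OF swap[OF less.prems]] by (cases "snd b \<le> snd a") auto
  qed
qed

text \<open>Both entries have cyclic component divisible by gcd(u, m), so every element does, in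
  particular one with component 1 modulo \<open>m\<close>.\<close>

lemma pair_orbit_cyclic_coprime:
  assumes "(((k, s), u), ((l, t), 0)) \<in> pair_orbit (dihedral_cyclic n m) f"
  shows "coprime u (int m)"
proof -
  let ?g = "gcd u (int m)"
  have "((0, False), 1 mod int m) \<in> carrier (dihedral_cyclic n m)"
    using n m by (simp add: carrier_dihedral_cyclic)
  moreover have "carrier (dihedral_cyclic n m) \<subseteq> {x \<in> carrier (dihedral_cyclic n m). ?g dvd snd x}"
    by (rule pair_orbit_generates[OF group_dihedral_cyclic assms subgroup_dvd_cyclic])
       (use pair_orbit_closed[OF group_dihedral_cyclic assms] in simp_all)
  ultimately have "?g dvd 1 mod int m"
    by (auto dest!: subsetD)
  then have "?g dvd 1"
    by (simp add: dvd_mod_iff)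
  then show ?thesis
    by (simp add: coprime_iff_gcd_eq_1)
qed

lemma pair_orbit_reflection:
  assumes "(a, b) \<in> pair_orbit (dihedral_cyclic n m) f" "snd b = 0"
  shows "\<exists>a b. (a, b) \<in> pair_orbit (dihedral_cyclic n m) f \<and> snd b = 0 \<and> snd (fst b)"
proof (cases "snd (fst b)")
  case True
  with assms show ?thesis by blast
next
  case False
  obtain k s u l where a: "a = ((k, s), u)" and b: "b = ((l, False), 0)"
    using assms(2) False by (cases a; cases "fst a"; cases b; cases "fst b") auto
  note ab = assms(1)[unfolded a b]
  have closed: "((k, s), u) \<in> carrier (dihedral_cyclic n m)" "((l, False), 0) \<in> carrier (dihedral_cyclic n m)"
    using pair_orbit_closed[OF group_dihedral_cyclic ab] by auto
  have refl: "((0, True), 0) \<in> carrier (dihedral_cyclic n m)"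
    using n m by (simp add: carrier_dihedral_cyclic)
  have s
  proof (rule ccontr)
    assume "\<not> s"
    have "subgroup {x \<in> carrier (dihedral_cyclic n m). \<not> snd (fst x)}
        (dihedral_cyclic n m)"
      by (rule subgroup_dihedral_cyclicI[where P = "\<lambda>k s z. \<not> s"]) auto
    then have "carrier (dihedral_cyclic n m) \<subseteq> {x \<in> carrier (dihedral_cyclic n m). \<not> snd (fst x)}"
      by (rule pair_orbit_generates[OF group_dihedral_cyclic ab])
         (use closed \<open>\<not> s\<close> in simp_all)
    with refl show False
      by (auto dest!: subsetD)
  qed
  have "odd m"
  proof
    assume "even m"
    then have "odd u"
      using pair_orbit_cyclic_coprime[OF ab] by (meson coprime_common_divisor even_of_nat odd_one)
    \<comment> \<open>Both entries satisfy the parity condition: \<open>a\<close> is a reflection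
      with odd component, \<open>b\<close> a rotation with component 0. The element (\<sigma>, 0)
      violates it.\<close>
    have "carrier (dihedral_cyclic n m) \<subseteq>
        {x \<in> carrier (dihedral_cyclic n m). snd (fst x) = odd (snd x)}"
      by (rule pair_orbit_generates[OF group_dihedral_cyclic ab subgroup_parity[OF \<open>even m\<close>]])
         (use closed \<open>s\<close> \<open>odd u\<close> in simp_all)
    with refl show False
      by (auto dest!: subsetD)
  qed
  \<comment> \<open>Here \<open>c\<close> plays the part of b a^-q. Each division by the reflection
    \<open>a\<close> flips the flag; after \<open>m\<close> divisions, an odd number,
    \<open>c\<close> is a reflection and its component -m u is 0 modulo \<open>m\<close>.\<close>
  have "\<exists>c. (c, a) \<in> pair_orbit (dihedral_cyclic n m) f \<and> snd (fst c) = odd q \<and>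
      snd c = (- (int q * u)) mod int m" for q
  proof (induction q)
    case 0
    then show ?case
      using pair_orbit_swap[OF group_dihedral_cyclic assms(1)] by (auto simp: b)
  next
    case (Suc q)
    then obtain c where c: "(c, a) \<in> pair_orbit (dihedral_cyclic n m) f" "snd (fst c) = odd q"
        "snd c = (- (int q * u)) mod int m"
      by blast
    obtain d where "(d, a) \<in> pair_orbit (dihedral_cyclic n m) f"
        "snd (fst d) = (snd (fst c) \<noteq> snd (fst a))" "snd d = (snd c - snd a) mod int m"
      by (rule pair_orbit_divide[OF c(1)])
    moreover have "(- (int q * u)) - u = - (int (Suc q) * u)"
      by (simp add: algebra_simps)
    ultimately show ?case
      using c \<open>s\<close> by (intro exI[of _ d]) (simp add: a mod_simps)
  qed
  from this[of m] \<open>odd m\<close> obtain c where c: "(c, a) \<in> pair_orbit (dihedral_cyclic n m) f"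
      "snd (fst c)" "snd c = 0"
    by auto
  show ?thesis
    using pair_orbit_swap[OF group_dihedral_cyclic c(1)] c(2,3) by blast
qed

lemma std_pair_in_pair_orbit:
  assumes "f \<in> Epi F2 (dihedral_cyclic n m)"
  shows "(((1 mod int n, False), 1 mod int m), ((0, True), 0)) \<in> pair_orbit (dihedral_cyclic n m) f"
proof -
  let ?G = "dihedral_cyclic n m" and ?O = "pair_orbit (dihedral_cyclic n m) f"
  obtain a0 b0 where ab0: "(a0, b0) \<in> ?O" "snd b0 = 0"
    using pair_orbit_euclid[OF pair_orbit_refl[OF group_dihedral_cyclic assms]] by blast
  obtain a b where ab: "(a, b) \<in> ?O" "snd b = 0" "snd (fst b)"
    using pair_orbit_reflection[OF ab0] by blast
  obtain a' where a': "(a', b) \<in> ?O" "\<not> snd (fst a')"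
  proof (cases "snd (fst a)")
    case True
    obtain c where "(c, b) \<in> ?O" "snd (fst c) = (snd (fst a) \<noteq> snd (fst b))"
      by (rule pair_orbit_divide[OF ab(1)])
    with True ab(3) that show thesis by simp
  next
    case False
    with ab(1) that show thesis by blast
  qed
  define k u l where "k = fst (fst a')" and "u = snd a'" and "l = fst (fst b)"
  have "a' = ((k, False), u)" "b = ((l, True), 0)"
    using ab(2,3) a'(2) by (simp_all add: k_def u_def l_def prod_eq_iff)
  with a' have klu: "(((k, False), u), ((l, True), 0)) \<in> ?O" by simp
  have closed: "((k, False), u) \<in> carrier ?G" "((l, True), 0) \<in> carrier ?G"
    using pair_orbit_closed[OF group_dihedral_cyclic klu] by auto
  \<comment> \<open>Modulo \<open>?g\<close> the first entry loses its rotation and the second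
    becomes r^l \<sigma>, so both lie in \<open>?H\<close>. Since \<open>?H\<close> must then
    contain r, \<open>?g\<close> is 1.\<close>
  let ?g = "gcd k (int n)"
  let ?H = "{x \<in> carrier ?G. [fst (fst x) = (if snd (fst x) then l else 0)] (mod ?g)}"
  have H: "subgroup ?H ?G"
    by (rule subgroup_dvd_rotation) simp
  have "((k, False), u) \<in> ?H" "((l, True), 0) \<in> ?H"
    using closed by (simp_all add: cong_0_iff)
  then have "carrier ?G \<subseteq> ?H"
    by (rule pair_orbit_generates[OF group_dihedral_cyclic klu H])
  moreover have "((1 mod int n, False), 0) \<in> carrier ?G"
    using n m by (simp add: carrier_dihedral_cyclic)
  ultimately have "((1 mod int n, False), 0) \<in> ?H"
    by (rule subsetD)
  then have "?g dvd 1 mod int n"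
    by (simp add: cong_0_iff)
  then have "?g dvd 1"
    by (simp add: dvd_mod_iff)
  then have "coprime k (int n)"
    by (simp add: coprime_iff_gcd_eq_1)
  then obtain p where "[k * p = 1] (mod int n)"
    using cong_solve_coprime_int by blast
  then have p: "[p * k = 1] (mod int n)"
    by (simp add: mult.commute)
  obtain v where "[u * v = 1] (mod int m)"
    using cong_solve_coprime_int pair_orbit_cyclic_coprime[OF klu] by blast
  then have v: "[v * u = 1] (mod int m)"
    by (simp add: mult.commute)
  have "coprime p (int n)" "coprime v (int m)"
    unfolding coprime_iff_invertible_int using p v by blast+
  \<comment> \<open>Here \<open>p\<close> and \<open>v\<close> invert \<open>k\<close> and
    \<open>u\<close>, so the first entry becomes (r, 1); the shift \<open>- (p * l)\<close> turns
    r^l \<sigma> into \<sigma>.\<close>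
  from pair_orbit_auto[OF group_dihedral_cyclic klu auto_dihedral_cyclic[OF this, of "- (p * l)"]]
  show ?thesis
    using p[unfolded cong_def] v[unfolded cong_def] closed by simp
qed

end

theorem proposition8p2:
  fixes n m :: nat
  assumes "n > 0" and "m > 0" and "odd n"
  shows "card (Aut_Epi_Aut F2 (dihedral_group n \<times>\<times> integer_mod_group m)) = 1"
proof -
  let ?G = "dihedral_cyclic n m"
  obtain h where h: "h \<in> Epi F2 ?G"
      "h gen_x = ((1 mod int n, False), 1 mod int m)" "h gen_y = ((0, True), 0)"
    by (rule std_pair_Epi[OF assms])
  \<comment> \<open>Every class contains the fixed epimorphism \<open>h\<close>, so symmetry and
    transitivity relate any two.\<close>
  have "(f, h) \<in> Epi_equiv F2 ?G" if "f \<in> Epi F2 ?G" for f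
    using std_pair_in_pair_orbit[OF assms(1,2) that] h
    by (intro Epi_equiv_if_pair_orbit[OF group_dihedral_cyclic]) auto
  then have "(f, f') \<in> Epi_equiv F2 ?G" if "f \<in> Epi F2 ?G" "f' \<in> Epi F2 ?G" for f f'
    using that equiv_Epi_equiv[OF group_F2 group_dihedral_cyclic] by (meson equivE symD transD)
  then show ?thesis
    unfolding card_Aut_Epi_Aut_eq_1_iff[OF group_F2 group_dihedral_cyclic]
    using h by (auto simp: Epi_equiv_iff)
qed

end
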